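(* Let $\varepsilon>0$ and $\frac12<\delta<1$. Then for all sufficiently large integers $s$, \[ \Omega\big(n^{1+\delta-\varepsilon}\big)=\mathbf{RT}_s(n,K_{s+1},n^\delta)=O\big(n^{1+\delta}\big) \] as $n\to\infty$.
   Context: For a graph $G$ and integer $s\ge 2$, the $s$-independence number $\alpha_s(G)$ is the maximum number of vertices of an induced subgraph of $G$ containing no copy of $K_s$. For a graph $H$ and a function $f=f(n)$, the Ramsey–Turán number $\mathbf{RT}_s(n,H,f)$ is the maximum number of edges of an $H$-free graph $G$ on $n$ vertices with $\alpha_s(G)<f$; if no such graph exists, $\mathbf{RT}_s(n,H,f)=0$. Asymptotic notation is as $n\to\infty$ with $s,\delta,\varepsilon$ fixed. Rounding of $n^\delta$ is ignored. *)

theory Defs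
  imports Complex_Main "HOL-Library.Ramsey" "HOL-Library.Landau_Symbols"
begin

text \<open>
  A finite simple undirected graph is a pair \<open>(V, E)\<close> of a finite vertex set and a set
  of two-element subsets of \<open>V\<close>.
\<close>

type_synonym 'a graph = "'a set \<times> 'a set set"

abbreviation vertices :: "'a graph \<Rightarrow> 'a set" where
  "vertices \<equiv> fst"

abbreviation edges :: "'a graph \<Rightarrow> 'a set set" where
  "edges \<equiv> snd"

definition fin_simple_graph :: "'a graph \<Rightarrow> bool" where
  "fin_simple_graph G \<longleftrightarrow> finite (vertices G) \<and> edges G \<subseteq> [vertices G]\<^bsup>2\<^esup>"

definition complete_graph :: "nat \<Rightarrow> nat graph" where
  "complete_graph m = ({..<m}, [{..<m}]\<^bsup>2\<^esup>)"

definition induced_subgraph :: "'a graph \<Rightarrow> 'a set \<Rightarrow> 'a graph" where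
  "induced_subgraph G S = (S, {e \<in> edges G. e \<subseteq> S})"

text \<open>A copy of \<open>H\<close> is a not necessarily induced subgraph isomorphic to \<open>H\<close>.\<close>

definition contains_copy :: "'a graph \<Rightarrow> 'b graph \<Rightarrow> bool" where
  "contains_copy G H \<longleftrightarrow>
     (\<exists>\<phi>. inj_on \<phi> (vertices H) \<and> \<phi> ` vertices H \<subseteq> vertices G \<and>
          (\<forall>e\<in>edges H. \<phi> ` e \<in> edges G))"

definition independence_number :: "nat \<Rightarrow> 'a graph \<Rightarrow> nat" where
  "independence_number s G =
     Max {card S |S. S \<subseteq> vertices G \<and>
            \<not> contains_copy (induced_subgraph G S) (complete_graph s)}"

text \<open>
  The set of edge numbers of the admissible graphs on \<open>n\<close> vertices. Every finite graph is
  isomorphic to one whose vertices are natural numbers. The threshold \<open>f n\<close> is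
  real, so it needs no rounding.
\<close>

definition RT_edge_counts :: "nat \<Rightarrow> nat \<Rightarrow> 'b graph \<Rightarrow> (nat \<Rightarrow> real) \<Rightarrow> nat set" where
  "RT_edge_counts s n H f =
     {card (edges G) |G :: nat graph.
        fin_simple_graph G \<and> card (vertices G) = n \<and> \<not> contains_copy G H \<and>
        real (independence_number s G) < f n}"

definition RT :: "nat \<Rightarrow> nat \<Rightarrow> 'b graph \<Rightarrow> (nat \<Rightarrow> real) \<Rightarrow> nat" where
  "RT s n H f =
     (if RT_edge_counts s n H f = {} then 0 else Max (RT_edge_counts s n H f))"

text \<open>The maxima above are taken over finite, and in the first case nonempty, sets.\<close>

lemma independence_number_set:
  assumes "fin_simple_graph G" and "s \<ge> 1"
  defines "A \<equiv> {card S |S. S \<subseteq> vertices G \<and>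
                  \<not> contains_copy (induced_subgraph G S) (complete_graph s)}"
  shows "finite A" and "A \<noteq> {}"
proof -
  have "A \<subseteq> card ` Pow (vertices G)"
    unfolding A_def by blast
  moreover have "finite (Pow (vertices G))"
    using assms(1) by (simp add: fin_simple_graph_def)
  ultimately show "finite A"
    by (meson finite_imageI finite_subset)
  have "\<not> contains_copy (induced_subgraph G {}) (complete_graph s)"
    using assms(2)
    by (auto simp: contains_copy_def induced_subgraph_def complete_graph_def lessThan_empty_iff bot_nat_def)
  then show "A \<noteq> {}"
    unfolding A_def by blast
qed

lemma finite_RT_edge_counts: "finite (RT_edge_counts s n H f)"
proof -
  have "card (edges G) \<le> n choose 2" if "fin_simple_graph G" "card (vertices G) = n"
    for G :: "nat graph"
  proof -
    have "card (edges G) \<le> card ([vertices G]\<^bsup>2\<^esup>)"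
      using that by (intro card_mono finite_imp_finite_nsets) (auto simp: fin_simple_graph_def)
    also have "\<dots> = n choose 2"
    proof -
      have "[vertices G]\<^bsup>2\<^esup> = {B. B \<subseteq> vertices G \<and> card B = 2}"
        using that by (auto simp: nsets_def fin_simple_graph_def dest: finite_subset)
      then show ?thesis
        using that n_subsets[of "vertices G" 2] by (simp add: fin_simple_graph_def)
    qed
    finally show ?thesis .
  qed
  then have "RT_edge_counts s n H f \<subseteq> {..n choose 2}"
    unfolding RT_edge_counts_def by auto
  then show ?thesis
    by (rule finite_subset) simp
qed

end

theory Submission
  imports Defs "HOL-Real_Asymp.Real_Asymp"
begin

text \<open>
  Upper bound: in a graph without \<open>K_(s+1)\<close> every neighbourhood is free of \<open>K_s\<close>, so all degrees
  are at most the \<open>s\<close>-independence number.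

  Lower bound: it suffices to find graphs without \<open>K_(s+1)\<close> on \<open>N\<close> vertices in which every set of
  \<open>N^(1/2 + o(1))\<close> vertices contains a \<open>K_s\<close>. By a greedy form of Turan's theorem such a graph
  has \<open>N^(3/2 - o(1))\<close> edges, and its balanced blow-up to \<open>n\<close> vertices, with \<open>N\<close> about
  \<open>n^(2 - 2 \<delta>)\<close>, has the required parameters; \<open>\<delta> > 1/2\<close> makes \<open>N \<le> n\<close>.

  The vertices of the small graph are the points of a \<open>q \<times> q\<close> integer grid, \<open>q = D^m\<close>, considered
  with the lines of slopes \<open>0, \<dots>, D - 1\<close>. Given three points that are not on a common line, only
  \<open>2 D^2\<close> points are collinear with all three. So for \<open>s \<ge> 6 m\<close> there are few sets of \<open>s + 1\<close>
  pairwise collinear points not on one line, and a random partition of the grid into \<open>D^4\<close> classes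
  has none inside a class. Colour the points of every line randomly with \<open>s\<close> colours, and join
  two points of a line if they have the same class and different colours. A clique then lies on one
  line, hence has at most \<open>s\<close> vertices, while with positive probability every set of \<open>D^(m+6)\<close>
  points contains points of all \<open>s\<close> colours on some line within some class.
\<close>

subsection \<open>Random colourings\<close>

text \<open>The union bound in counting form: the bad sets together have fewer elements than
  \<open>S\<close>. Both random colourings below are obtained from it.\<close>

lemma ex_avoiding_bad_sets:
  assumes "finite F" "finite S" "\<And>e. e \<in> F \<Longrightarrow> B e \<subseteq> S \<and> card (B e) \<le> b" "card F * b < card S"
  shows "\<exists>c\<in>S. \<forall>e\<in>F. c \<notin> B e"
proof (rule ccontr)
  assume "\<not> ?thesis"
  then have "S \<subseteq> (\<Union>e\<in>F. B e)" by blast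
  moreover have "finite (\<Union>e\<in>F. B e)"
    using assms by (meson finite_UN finite_subset)
  ultimately have "card S \<le> card (\<Union>e\<in>F. B e)"
    by (rule card_mono[rotated])
  also have "\<dots> \<le> (\<Sum>e\<in>F. card (B e))"
    by (rule card_UN_le[OF assms(1)])
  also have "\<dots> \<le> card F * b"
    using sum_bounded_above[of F "\<lambda>e. card (B e)" b] assms(3) by simp
  finally show False using assms(4) by simp
qed

text \<open>A random colouring with \<open>k\<close> colours makes a given set of
  \<open>r + 1\<close> points monochromatic with probability \<open>1 / k ^ r\<close>, so fewer than
  \<open>k ^ r\<close> such sets can be avoided at once. This will supply the classes of the
  grid.\<close>

lemma ex_coloring_no_monochromatic:
  fixes k r :: nat
  assumes X: "finite X" and F: "finite F" and k: "k > 0"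
    and e: "\<And>e. e \<in> F \<Longrightarrow> e \<subseteq> X \<and> card e = Suc r" and less: "card F < k ^ r"
  shows "\<exists>c. c ` X \<subseteq> {..<k} \<and> (\<forall>e\<in>F. \<not> (\<exists>j. \<forall>x\<in>e. c x = j))"
proof (cases "F = {}")
  case True
  then show ?thesis using k by (intro exI[of _ "\<lambda>_. 0"]) auto
next
  case False
  \<comment> \<open>A member of \<open>F\<close> gives this bound, which keeps the exponent
    \<open>card X - Suc r\<close> from being truncated.\<close>
  then have le: "Suc r \<le> card X" using e X by (metis card_mono ex_in_conv)
  define S where "S = X \<rightarrow>\<^sub>E {..<k}"
  define B where "B e = (\<Union>j<k. PiE X (\<lambda>x. if x \<in> e then {j} else {..<k}))" for e
  have "\<exists>c\<in>S. \<forall>e\<in>F. c \<notin> B e"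
  proof (rule ex_avoiding_bad_sets[where b = "k * k ^ (card X - Suc r)"])
    show "finite S" unfolding S_def using X by (intro finite_PiE) auto
    show "B e \<subseteq> S \<and> card (B e) \<le> k * k ^ (card X - Suc r)" if "e \<in> F" for e
    proof
      show "B e \<subseteq> S" unfolding B_def S_def by (intro UN_least PiE_mono) auto
      have "card (PiE X (\<lambda>x. if x \<in> e then {j} else {..<k})) = k ^ (card X - Suc r)" for j
      proof -
        have "card (PiE X (\<lambda>x. if x \<in> e then {j} else {..<k})) = (\<Prod>x\<in>X. if x \<in> e then 1 else k)"
          using X by (auto simp: card_PiE intro!: prod.cong)
        also have "\<dots> = k ^ card (X - e)"
          using X by (simp add: prod.If_cases Diff_eq)
        also have "card (X - e) = card X - Suc r"
          using e[OF that] X by (metis card_Diff_subset finite_subset)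
        finally show ?thesis .
      qed
      then show "card (B e) \<le> k * k ^ (card X - Suc r)"
        unfolding B_def using card_UN_le[of "{..<k}"] by (metis (no_types, lifting) card_lessThan finite_lessThan sum_constant sum.cong of_nat_id)
    qed
    have "k * k ^ (card X - Suc r) = k ^ (card X - r)"
      using le by (metis Suc_diff_le Suc_le_lessD diff_Suc_Suc less_imp_le power_Suc)
    moreover have "k ^ (card X - r) * k ^ r = k ^ card X"
      using le by (simp flip: power_add)
    ultimately show "card F * (k * k ^ (card X - Suc r)) < card S"
      unfolding S_def using less X k by (simp add: card_PiE) (metis mult.commute mult_less_cancel1 zero_less_power)
  qed (use F in auto)
  then obtain c where c: "c \<in> S" "\<forall>e\<in>F. c \<notin> B e" by blast
  have False if "e \<in> F" "\<forall>x\<in>e. c x = j" for e j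
  proof -
    have "e \<noteq> {}" using e[OF that(1)] by auto
    then have "j < k" using that e[OF that(1)] c(1) unfolding S_def by (auto simp: PiE_iff)
    then have "c \<in> B e" using that c(1) unfolding B_def S_def by (auto simp: PiE_iff)
    then show False using c that by blast
  qed
  then have "\<forall>e\<in>F. \<not> (\<exists>j. \<forall>x\<in>e. c x = j)" by blast
  then show ?thesis using c(1) unfolding S_def by (intro exI[of _ c] conjI) (auto simp: PiE_iff)
qed

text \<open>If no cell shows all \<open>s\<close> colours on \<open>U\<close>, then some
  \<open>g\<close> picks for each cell a colour missing there, so
  \<open>f x \<noteq> g (\<kappa> x)\<close> on all of \<open>U\<close>. For fixed \<open>g\<close>
  a random \<open>f\<close> does this with probability \<open>(1 - 1/s) ^ u\<close>, and there are
  \<open>s ^ card C\<close> choices of \<open>g\<close>; \<open>less\<close> is the resulting union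
  bound.\<close>

lemma ex_coloring_full_cell:
  fixes s u :: nat
  assumes I: "finite I" and C: "finite C" "\<kappa> ` I \<subseteq> C" and F: "finite F" 
    and U: "\<And>U. U \<in> F \<Longrightarrow> U \<subseteq> I \<and> card U = u"
    and less: "card F * s ^ card C * (s - 1) ^ u < s ^ u" and s: "s > 0"
  shows "\<exists>f. f ` I \<subseteq> {..<s} \<and> (\<forall>U\<in>F. \<exists>z. \<forall>i<s. \<exists>x\<in>U. \<kappa> x = z \<and> f x = i)"
proof (cases "F = {}")
  case True
  then show ?thesis using s by (intro exI[of _ "\<lambda>_. 0"]) auto
next
  case False
  then have le: "u \<le> card I" using U I by (metis card_mono ex_in_conv)
  define S where "S = I \<rightarrow>\<^sub>E {..<s}"
  define B where "B U = (\<Union>g\<in>C \<rightarrow>\<^sub>E {..<s}. PiE I (\<lambda>x. if x \<in> U then {..<s} - {g (\<kappa> x)} else {..<s}))" for U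
  have "\<exists>f\<in>S. \<forall>U\<in>F. f \<notin> B U"
  proof (rule ex_avoiding_bad_sets[where b = "s ^ card C * ((s - 1) ^ u * s ^ (card I - u))"])
    show "finite S" unfolding S_def using I by (intro finite_PiE) auto
    show "B U \<subseteq> S \<and> card (B U) \<le> s ^ card C * ((s - 1) ^ u * s ^ (card I - u))" if "U \<in> F" for U
    proof
      show "B U \<subseteq> S" unfolding B_def S_def by (intro UN_least PiE_mono) auto
      have *: "card (PiE I (\<lambda>x. if x \<in> U then {..<s} - {g (\<kappa> x)} else {..<s})) = (s - 1) ^ u * s ^ (card I - u)"
        if "g \<in> C \<rightarrow>\<^sub>E {..<s}" for g
      proof -
        have "card (PiE I (\<lambda>x. if x \<in> U then {..<s} - {g (\<kappa> x)} else {..<s})) = (\<Prod>x\<in>I. if x \<in> U then s - 1 else s)"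
          using I C that by (subst card_PiE) (auto intro!: prod.cong simp: PiE_iff)
        also have "\<dots> = (s - 1) ^ card (I \<inter> U) * s ^ card (I - U)"
          using I by (simp add: prod.If_cases Diff_eq)
        also have "card (I - U) = card I - u"
          using U[OF \<open>U \<in> F\<close>] I by (metis card_Diff_subset finite_subset)
        also have "I \<inter> U = U" using U[OF \<open>U \<in> F\<close>] by blast
        finally show ?thesis using U[OF \<open>U \<in> F\<close>] by simp
      qed
      have "card (B U) \<le> (\<Sum>g\<in>C \<rightarrow>\<^sub>E {..<s}. card (PiE I (\<lambda>x. if x \<in> U then {..<s} - {g (\<kappa> x)} else {..<s})))"
        unfolding B_def using C by (intro card_UN_le finite_PiE) auto
      also have "\<dots> = (\<Sum>g\<in>C \<rightarrow>\<^sub>E {..<s}. (s - 1) ^ u * s ^ (card I - u))"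
        by (intro sum.cong *) auto
      finally show "card (B U) \<le> s ^ card C * ((s - 1) ^ u * s ^ (card I - u))"
        using C by (simp add: card_PiE)
    qed
    have eq: "s ^ u * s ^ (card I - u) = s ^ card I"
      using le by (simp flip: power_add)
    have "card F * s ^ card C * (s - 1) ^ u * s ^ (card I - u) < s ^ u * s ^ (card I - u)"
      using less s by (intro mult_strict_right_mono) auto
    then show "card F * (s ^ card C * ((s - 1) ^ u * s ^ (card I - u))) < card S"
      unfolding S_def using I eq by (simp add: card_PiE mult.assoc)
  qed (use F in auto)
  then obtain f where f: "f \<in> S" "\<forall>U\<in>F. f \<notin> B U" by blast
  have "\<exists>z. \<forall>i<s. \<exists>x\<in>U. \<kappa> x = z \<and> f x = i" if "U \<in> F" for U
  proof (rule ccontr)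
    assume "\<not> ?thesis"
    then have "\<forall>z. \<exists>i. i < s \<and> (\<forall>x\<in>U. \<kappa> x = z \<longrightarrow> f x \<noteq> i)" by blast
    then obtain g where g: "\<And>z. g z < s \<and> (\<forall>x\<in>U. \<kappa> x = z \<longrightarrow> f x \<noteq> g z)" by metis
    \<comment> \<open>The index set of \<open>B U\<close> holds extensional functions only.
      Restricting \<open>g\<close> changes no value that matters, since \<open>\<kappa>\<close> maps
      \<open>I\<close> into \<open>C\<close>.\<close>
    have "f \<in> PiE I (\<lambda>x. if x \<in> U then {..<s} - {restrict g C (\<kappa> x)} else {..<s})"
      using f(1) g C U[OF that] unfolding S_def by (auto simp: PiE_iff image_subset_iff)
    moreover have "restrict g C \<in> C \<rightarrow>\<^sub>E {..<s}" using g by auto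
    ultimately have "f \<in> B U" unfolding B_def by blast
    then show False using f that by blast
  qed
  then show ?thesis using f(1) unfolding S_def by (intro exI[of _ f]) (auto simp: PiE_iff)
qed

text \<open>After division by \<open>s ^ D\<close>, a polynomial in \<open>D\<close> competes with
  the exponentially small \<open>(1 - 1/s) ^ D\<close>. This provides the hypothesis
  \<open>small\<close> of the construction for large \<open>D\<close>.\<close>

lemma eventually_power_mult_less:
  fixes s j :: nat
  assumes "s \<ge> 1"
  shows "eventually (\<lambda>D. s^2 * D ^ j * (s - 1) ^ D < s ^ D) at_top"
proof -
  define c where "c = (real s - 1) / real s"
  have c: "0 \<le> c" "c < 1" using assms by (auto simp: c_def)
  have "(\<lambda>D. real s ^2 * real D ^ j * c ^ D) \<longlonglongrightarrow> 0"
  proof (cases "c = 0")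
    case True then show ?thesis by real_asymp
  next
    case False
    with c have "0 < c" by simp
    then show ?thesis using c by real_asymp
  qed
  then have "eventually (\<lambda>D. real s ^2 * real D ^ j * c ^ D < 1) at_top"
    by (rule order_tendstoD) simp
  then show ?thesis
  proof eventually_elim
    case (elim D)
    have "real s ^2 * real D ^ j * c ^ D * real s ^ D < 1 * real s ^ D"
      using elim assms by (intro mult_strict_right_mono) auto
    moreover have "c ^ D * real s ^ D = real (s - 1) ^ D"
      using assms by (simp add: c_def of_nat_diff flip: power_mult_distrib)
    ultimately have "real (s^2 * D ^ j * (s - 1) ^ D) < real (s ^ D)"
      by (simp add: mult.assoc)
    then show ?case by (simp only: of_nat_less_iff)
  qed
qed

subsection \<open>The grid graph\<close>

text \<open>Non-vertical lines are encoded by slope and intercept.\<close>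

definition icpt :: "int \<Rightarrow> int \<times> int \<Rightarrow> int" where
  "icpt a p = snd p - a * fst p"

text \<open>With equal first coordinates, equal intercepts would force the points to coincide; as
  these coordinates differ, two points fix the slope.\<close>

lemma icpt_unique:
  assumes "p \<noteq> p'" "icpt a p = icpt a p'" "icpt b p = icpt b p'"
  shows "a = b"
proof -
  have 1: "(a - b) * (fst p - fst p') = 0"
    using assms(2,3) by (simp add: icpt_def algebra_simps)
  have "fst p \<noteq> fst p'" using assms(1,2) by (auto simp: icpt_def prod_eq_iff)
  then show ?thesis using 1 by simp
qed

lemma card_icpt_inter:
  assumes "a \<noteq> b"
  shows "finite {p. icpt a p = z \<and> icpt b p = z'} \<and> card {p. icpt a p = z \<and> icpt b p = z'} \<le> 1"
proof -
  let ?S = "{p. icpt a p = z \<and> icpt b p = z'}"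
  show ?thesis
  proof (cases "?S = {}")
    case False
    then obtain p where p: "p \<in> ?S" by auto
    have "?S \<subseteq> {p}"
    proof
      fix p' assume "p' \<in> ?S"
      then show "p' \<in> {p}" using icpt_unique[of p p' a b] assms p by auto
    qed
    then show ?thesis using finite_subset[of ?S "{p}"] card_mono[of "{p}" ?S] by simp
  qed (metis card.empty finite.emptyI zero_le)
qed

definition col :: "nat \<Rightarrow> int \<times> int \<Rightarrow> int \<times> int \<Rightarrow> bool" where
  "col D p p' \<longleftrightarrow> (\<exists>a\<in>{0..<int D}. icpt a p = icpt a p')"

definition on_line :: "nat \<Rightarrow> (int \<times> int) set \<Rightarrow> bool" where
  "on_line D K \<longleftrightarrow> (\<exists>a\<in>{0..<int D}. \<forall>x\<in>K. \<forall>y\<in>K. icpt a x = icpt a y)"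

text \<open>Such an \<open>x\<close> lies on lines of slopes \<open>a\<close>, \<open>b\<close>,
  \<open>c\<close> through \<open>u\<close>, \<open>v\<close>, \<open>w\<close>. These slopes are
  not all equal, or the three points would share a line, so \<open>x\<close> is where the line
  through \<open>u\<close> meets a non-parallel line through \<open>v\<close> or through
  \<open>w\<close>. Either alternative allows at most \<open>D^2\<close> pairs of slopes.\<close>

lemma card_common_col:
  assumes "\<not> on_line D {u, v, w}"
  defines "N \<equiv> {x. col D x u \<and> col D x v \<and> col D x w}"
  shows "finite N \<and> card N \<le> 2 * D^2"
proof -
  define A where "A = {0..<int D}"
  \<comment> \<open>Parallel lines get the empty set, so that every value of \<open>T v'\<close> has
    at most one point.\<close>
  define T where "T v' = (\<lambda>(a, b). if a = b then {} else {p. icpt a p = icpt a u \<and> icpt b p = icpt b v'})"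
    for v'
  have T: "finite (T v' z) \<and> card (T v' z) \<le> 1" for v' z
    unfolding T_def using card_icpt_inter by (auto split: prod.splits)
  have "N \<subseteq> (\<Union>z\<in>A\<times>A. T v z) \<union> (\<Union>z\<in>A\<times>A. T w z)"
  proof
    fix x assume "x \<in> N"
    then obtain a b c where abc: "a \<in> A" "b \<in> A" "c \<in> A"
      "icpt a x = icpt a u" "icpt b x = icpt b v" "icpt c x = icpt c w"
      unfolding N_def col_def A_def by blast
    have "a \<noteq> b \<or> a \<noteq> c"
    proof (rule ccontr)
      assume "\<not> ?thesis"
      then have "\<forall>y\<in>{u, v, w}. icpt a y = icpt a x" using abc by auto
      then have "on_line D {u, v, w}" using abc(1) unfolding on_line_def A_def by metis
      then show False using assms by blast
    qed
    then have "x \<in> T v (a, b) \<or> x \<in> T w (a, c)"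
      using abc unfolding T_def by auto
    then show "x \<in> (\<Union>z\<in>A\<times>A. T v z) \<union> (\<Union>z\<in>A\<times>A. T w z)"
      using abc by blast
  qed
  moreover have T2: "finite (\<Union>z\<in>A\<times>A. T v' z) \<and> card (\<Union>z\<in>A\<times>A. T v' z) \<le> D^2" for v'
  proof
    show "finite (\<Union>z\<in>A\<times>A. T v' z)" using T by (auto simp: A_def)
    have "card (\<Union>z\<in>A\<times>A. T v' z) \<le> (\<Sum>z\<in>A\<times>A. card (T v' z))"
      by (intro card_UN_le) (auto simp: A_def)
    also have "\<dots> \<le> (\<Sum>z\<in>A\<times>A. 1)" by (intro sum_mono) (use T in auto)
    also have "\<dots> = D^2" by (simp add: A_def power2_eq_square)
    finally show "card (\<Union>z\<in>A\<times>A. T v' z) \<le> D^2" .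
  qed
  ultimately have "finite N" "card N \<le> card ((\<Union>z\<in>A\<times>A. T v z) \<union> (\<Union>z\<in>A\<times>A. T w z))"
    using finite_subset card_mono finite_Un by metis+
  then show ?thesis
    using card_Un_le[of "\<Union>z\<in>A\<times>A. T v z" "\<Union>z\<in>A\<times>A. T w z"] T2[of v] T2[of w] by linarith
qed

text \<open>Take the line through two points of \<open>K\<close> and a point \<open>w\<close> of
  \<open>K\<close> off it. A line through all three would share two points with the first line,
  hence have its slope.\<close>

lemma obtain_triple_not_on_line:
  assumes "pairwise (col D) K" "\<not> on_line D K" "card K \<ge> 2"
  obtains u v w where "{u, v, w} \<subseteq> K" "distinct [u, v, w]" "\<not> on_line D {u, v, w}"
proof -
  have "\<exists>u v. u \<in> K \<and> v \<in> K \<and> u \<noteq> v"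
    using assms(3) by (metis card_le_Suc0_iff_eq card.infinite not_less_eq_eq numeral_2_eq_2 zero_le le_zero_eq nat.distinct(1))
  then obtain u v where uv: "u \<in> K" "v \<in> K" "u \<noteq> v" by blast
  then obtain a where a: "a \<in> {0..<int D}" "icpt a u = icpt a v"
    using assms(1) unfolding pairwise_def col_def by blast
  obtain w where w: "w \<in> K" "icpt a w \<noteq> icpt a u"
    using assms(2) a(1) unfolding on_line_def by metis
  have "\<not> on_line D {u, v, w}"
  proof
    assume "on_line D {u, v, w}"
    then obtain b where "icpt b u = icpt b v" "icpt b w = icpt b u"
      unfolding on_line_def by auto
    then show False using icpt_unique[OF uv(3) a(2)] w by metis
  qed
  moreover have "distinct [u, v, w]" using uv w a by auto
  ultimately show ?thesis using that uv w by blast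
qed

definition grid :: "nat \<Rightarrow> (int \<times> int) set" where
  "grid q = {0..<int q} \<times> {0..<int q}"

lemma finite_grid [simp]: "finite (grid q)" and card_grid: "card (grid q) = q^2"
  by (simp_all add: grid_def power2_eq_square)

text \<open>Each member of \<open>F\<close> consists of a triple that is not on a line and
  \<open>s - 2\<close> further points, all collinear with the three. The triple has at most
  \<open>q^6\<close> choices, every further point at most \<open>2 * D^2\<close> by
  \<open>card_common_col\<close>.\<close>

lemma card_col_cliques_le:
  fixes q D s :: nat
  assumes "s \<ge> 2"
  defines "F \<equiv> {K. K \<subseteq> grid q \<and> card K = Suc s \<and> pairwise (col D) K \<and> \<not> on_line D K}"
  shows "card F \<le> q^6 * (2 * D^2) ^ (s - 2)"
proof -
  define N where "N = (\<lambda>(u, v, w). {x. col D x u \<and> col D x v \<and> col D x w})"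
  define T where "T = {(u, v, w). (u, v, w) \<in> grid q \<times> grid q \<times> grid q \<and> \<not> on_line D {u, v, w}}"
  define H where "H = (\<lambda>(u, v, w). (\<lambda>M. {u, v, w} \<union> M) ` {M. M \<subseteq> N (u, v, w) \<and> card M = s - 2})"
  have T: "T \<subseteq> grid q \<times> grid q \<times> grid q" unfolding T_def by auto
  have finT: "finite T" by (rule finite_subset[OF T]) simp
  have cardT: "card T \<le> q^6"
    using card_mono[OF _ T] by (simp add: card_cartesian_product card_grid power_numeral_reduce)
  have H: "finite (H t) \<and> card (H t) \<le> (2 * D^2) ^ (s - 2)" if "t \<in> T" for t
  proof -
    obtain u v w where t: "t = (u, v, w)" by (cases t)
    have N: "finite (N t)" "card (N t) \<le> 2 * D^2"
      using card_common_col[of D u v w] that unfolding t T_def N_def by auto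
    let ?S = "{M. M \<subseteq> N t \<and> card M = s - 2}"
    have "finite ?S" using N by simp
    then have "card (H t) \<le> card ?S" "finite (H t)"
      unfolding H_def t by (auto intro: card_image_le)
    moreover have "card ?S = card (N t) choose (s - 2)" using N by (simp add: n_subsets)
    moreover have "card (N t) choose (s - 2) \<le> card (N t) ^ (s - 2)"
      by (metis binomial_le_pow binomial_eq_0 not_le zero_le)
    moreover have "card (N t) ^ (s - 2) \<le> (2 * D^2) ^ (s - 2)" using N by (intro power_mono) auto
    ultimately show ?thesis by linarith
  qed
  have "F \<subseteq> (\<Union>t\<in>T. H t)"
  proof
    fix K assume "K \<in> F"
    then have K: "K \<subseteq> grid q" "card K = Suc s" "pairwise (col D) K" "\<not> on_line D K"
      unfolding F_def by auto
    have "card K \<ge> 2" using K(2) assms(1) by simp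
    then obtain u v w where uvw: "{u, v, w} \<subseteq> K" "distinct [u, v, w]" "\<not> on_line D {u, v, w}"
      by (rule obtain_triple_not_on_line[OF K(3,4)])
    have "card (K - {u, v, w}) = s - 2"
      using uvw K(2) by (subst card_Diff_subset) auto
    moreover have "K - {u, v, w} \<subseteq> N (u, v, w)"
      using K(3) uvw(1) unfolding N_def pairwise_def by auto
    moreover have "K = {u, v, w} \<union> (K - {u, v, w})" using uvw by blast
    ultimately have "K \<in> H (u, v, w)" unfolding H_def by blast
    moreover have "(u, v, w) \<in> T" unfolding T_def using uvw K(1) by auto
    ultimately show "K \<in> (\<Union>t\<in>T. H t)" by blast
  qed
  then have "card F \<le> card (\<Union>t\<in>T. H t)" using H finT by (intro card_mono) auto
  also have "\<dots> \<le> (\<Sum>t\<in>T. card (H t))" by (rule card_UN_le[OF finT])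
  also have "\<dots> \<le> card T * (2 * D^2) ^ (s - 2)"
    using sum_bounded_above[of T "\<lambda>t. card (H t)"] H by simp
  also have "\<dots> \<le> q^6 * (2 * D^2) ^ (s - 2)" using cardT by simp
  finally show ?thesis .
qed

text \<open>Limits the number of lines of each slope that meet the grid to \<open>q + D * q\<close>,
  as needed for counting cells.\<close>

lemma icpt_range:
  assumes "p \<in> grid q" "a \<in> {0..<int D}"
  shows "icpt a p \<in> {- int (D * q)..<int q}"
proof -
  have "0 \<le> a * fst p" "a * fst p \<le> int D * int q"
    using assms by (auto simp: grid_def intro!: mult_mono)
  moreover have "0 \<le> snd p" "snd p < int q" using assms by (auto simp: grid_def)
  ultimately show ?thesis by (simp add: icpt_def)
qed

text \<open>The sizes fit as follows. A cell is a line together with a class, and there are at most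
  \<open>2 * w\<close> cells for \<open>w = D ^ (m + 6)\<close>. A set of \<open>w\<close> points
  has \<open>D * w\<close> incidences with lines, and there are at most
  \<open>D ^ (2 * m * w)\<close> such sets. The union bound of \<open>ex_coloring_full_cell\<close>
  is then the \<open>w\<close>-th power of \<open>small\<close>.\<close>

lemma ex_grid_graph:
  fixes m s D :: nat
  assumes s: "s \<ge> 6 * m" "s \<ge> 2" and D: "D \<ge> 2"
    and small: "s^2 * D ^ (2 * m) * (s - 1) ^ D < s ^ D"
  shows "\<exists>R. symp R \<and> irreflp R \<and>
    (\<forall>K\<subseteq>grid (D ^ m). card K = Suc s \<longrightarrow> \<not> pairwise R K) \<and>
    (\<forall>W\<subseteq>grid (D ^ m). card W = D ^ (m + 6) \<longrightarrow> (\<exists>K\<subseteq>W. card K = s \<and> pairwise R K))"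
proof -
  define q where "q = D ^ m"
  define k where "k = D ^ 4"
  define w where "w = D ^ (m + 6)"
  define A where "A = {0..<int D}"
  define F where "F = {K. K \<subseteq> grid q \<and> card K = Suc s \<and> pairwise (col D) K \<and> \<not> on_line D K}"
  \<comment> \<open>The bound becomes \<open>D ^ (6 * m + 3 * (s - 2))\<close>, and
    \<open>6 * m \<le> s\<close> brings the exponent below \<open>4 * s\<close>. This is why
    \<open>D ^ 4\<close> classes suffice.\<close>
  have "card F \<le> q^6 * (2 * D^2) ^ (s - 2)"
    unfolding F_def using card_col_cliques_le s(2) by blast
  also have "\<dots> \<le> D ^ (6 * m) * (D ^ 3) ^ (s - 2)"
  proof (intro mult_mono power_mono)
    show "q ^ 6 \<le> D ^ (6 * m)" by (simp add: q_def mult.commute flip: power_mult)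
    show "2 * D\<^sup>2 \<le> D ^ 3" using D by (simp add: power2_eq_square power3_eq_cube)
  qed auto
  also have "\<dots> = D ^ (6 * m + 3 * (s - 2))" by (simp add: power_add power_mult)
  also have "\<dots> < D ^ (4 * s)" using D s by (intro power_strict_increasing) auto
  also have "\<dots> = k ^ s" by (simp add: k_def power_mult)
  finally have cF: "card F < k ^ s" .
  have "finite F" by (rule finite_subset[of _ "Pow (grid q)"]) (auto simp: F_def)
  then have "\<exists>c. c ` grid q \<subseteq> {..<k} \<and> (\<forall>e\<in>F. \<not> (\<exists>j. \<forall>x\<in>e. c x = j))"
    by (rule ex_coloring_no_monochromatic[rotated, OF _ _ _ cF]) (use D in \<open>auto simp: F_def k_def\<close>)
  then obtain c where c: "c ` grid q \<subseteq> {..<k}" "\<forall>e\<in>F. \<not> (\<exists>j. \<forall>x\<in>e. c x = j)"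
    by (elim exE conjE) (rule that)
  define C where "C = A \<times> {- int (D * q)..<int q} \<times> {..<k}"
  define \<kappa> where "\<kappa> = (\<lambda>(a, p). (a, icpt a p, c p))"
  define \<W> where "\<W> = {W. W \<subseteq> grid q \<and> card W = w}"
  have "card C = D * (q + D * q) * k"
    by (simp add: C_def A_def nat_add_distrib nat_mult_distrib)
  also have "\<dots> \<le> D * (D * q + D * q) * k" using D by (intro mult_mono add_mono) auto
  also have "\<dots> = 2 * (D ^ m * (D * D * D ^ 4))" by (simp add: q_def k_def algebra_simps)
  also have "D * D * D ^ 4 = D ^ 6" by (simp add: eval_nat_numeral)
  also have "2 * (D ^ m * D ^ 6) = 2 * w" by (simp add: w_def power_add)
  finally have cC: "card C \<le> 2 * w" .
  have "card ((\<times>) A ` \<W>) \<le> card \<W>" by (intro card_image_le) (auto simp: \<W>_def)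
  also have "card \<W> = q^2 choose w" by (simp add: \<W>_def n_subsets card_grid)
  also have "\<dots> \<le> (q^2) ^ w" by (metis binomial_le_pow binomial_eq_0 not_le zero_le)
  finally have cW: "card ((\<times>) A ` \<W>) \<le> (D ^ (2 * m)) ^ w"
    by (simp add: q_def mult.commute flip: power_mult)
  have "card ((\<times>) A ` \<W>) * s ^ card C * (s - 1) ^ (D * w) \<le> (D ^ (2 * m)) ^ w * s ^ (2 * w) * (s - 1) ^ (D * w)"
    using cW cC s by (intro mult_mono power_increasing) auto
  also have "\<dots> = (s^2 * D ^ (2 * m) * (s - 1) ^ D) ^ w"
    by (simp add: power_mult_distrib ac_simps flip: power_mult)
  also have "\<dots> < (s ^ D) ^ w" using small D by (intro power_strict_mono) (auto simp: w_def)
  also have "\<dots> = s ^ (D * w)" by (simp add: power_mult)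
  finally have less: "card ((\<times>) A ` \<W>) * s ^ card C * (s - 1) ^ (D * w) < s ^ (D * w)" .
  \<comment> \<open>The colouring is defined on pairs of a slope and a point, so a point has a
    separate colour on each of its \<open>D\<close> lines. A point set \<open>W\<close> enters as
    \<open>A \<times> W\<close>.\<close>
  have "\<exists>f. f ` (A \<times> grid q) \<subseteq> {..<s} \<and>
    (\<forall>U\<in>(\<times>) A ` \<W>. \<exists>z. \<forall>i<s. \<exists>x\<in>U. \<kappa> x = z \<and> f x = i)"
  proof (rule ex_coloring_full_cell[where C = C and u = "D * w"])
    show "\<kappa> ` (A \<times> grid q) \<subseteq> C"
      using c(1) icpt_range[of _ q _ D] unfolding \<kappa>_def C_def A_def by auto
    show "U \<subseteq> A \<times> grid q \<and> card U = D * w" if "U \<in> (\<times>) A ` \<W>" for U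
      using that by (auto simp: \<W>_def A_def card_cartesian_product)
  qed (use less s in \<open>auto simp: A_def C_def \<W>_def\<close>)
  then obtain f where f: "f ` (A \<times> grid q) \<subseteq> {..<s}"
    "\<forall>U\<in>(\<times>) A ` \<W>. \<exists>z. \<forall>i<s. \<exists>x\<in>U. \<kappa> x = z \<and> f x = i"
    by (elim exE conjE) (rule that)
  define R where "R x y \<longleftrightarrow> c x = c y \<and> (\<exists>a\<in>A. icpt a x = icpt a y \<and> f (a, x) \<noteq> f (a, y))" for x y
  have "symp R" unfolding symp_def R_def by metis
  moreover have "irreflp R" unfolding irreflp_def R_def by blast
  moreover have "\<not> pairwise R K" if K: "K \<subseteq> grid q" "card K = Suc s" for K
  proof
    assume R: "pairwise R K"
    then have "pairwise (col D) K" unfolding R_def col_def A_def pairwise_def by blast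
    have "on_line D K"
    proof (rule ccontr)
      assume "\<not> on_line D K"
      then have "K \<in> F" using K \<open>pairwise (col D) K\<close> unfolding F_def by blast
      obtain x where "x \<in> K" using K(2) by (metis card.empty ex_in_conv nat.distinct(1))
      then have "\<forall>y\<in>K. c y = c x" using R unfolding pairwise_def R_def by metis
      then show False using c(2) \<open>K \<in> F\<close> by metis
    qed
    then obtain a where a: "a \<in> A" "\<And>x y. x \<in> K \<Longrightarrow> y \<in> K \<Longrightarrow> icpt a x = icpt a y"
      unfolding on_line_def A_def by blast
    \<comment> \<open>Two points of \<open>K\<close> are adjacent through some slope, which must be
      \<open>a\<close> because two points determine it. Hence their colours on the common line
      differ.\<close>
    have "inj_on (\<lambda>x. f (a, x)) K"
    proof (rule inj_onI, rule ccontr)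
      fix x y assume xy: "x \<in> K" "y \<in> K" "f (a, x) = f (a, y)" "x \<noteq> y"
      then obtain b where b: "icpt b x = icpt b y" "f (b, x) \<noteq> f (b, y)"
        using R unfolding pairwise_def R_def by blast
      then have "a = b" using icpt_unique xy a(2) by metis
      then show False using b xy by blast
    qed
    moreover have "(\<lambda>x. f (a, x)) ` K \<subseteq> {..<s}" using f(1) a(1) K(1) by auto
    ultimately have "card K \<le> card {..<s}" by (intro card_inj_on_le) auto
    then show False using K(2) by simp
  qed
  moreover have "\<exists>K\<subseteq>W. card K = s \<and> pairwise R K" if W: "W \<subseteq> grid q" "card W = w" for W
  proof -
    \<comment> \<open>One point for each colour in a full cell gives the clique: same line, same
      class, different colours.\<close>
    have "A \<times> W \<in> (\<times>) A ` \<W>" using W by (simp add: \<W>_def)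
    from bspec[OF f(2) this] obtain a b j where "\<forall>i<s. \<exists>x\<in>A \<times> W. \<kappa> x = (a, b, j) \<and> f x = i"
      by (metis prod_cases3)
    then have "\<forall>i\<in>{..<s}. \<exists>p. a \<in> A \<and> p \<in> W \<and> icpt a p = b \<and> c p = j \<and> f (a, p) = i"
      unfolding \<kappa>_def by fastforce
    then obtain p where p: "\<And>i. i < s \<Longrightarrow> a \<in> A \<and> p i \<in> W \<and> icpt a (p i) = b \<and> c (p i) = j \<and> f (a, p i) = i"
      by (metis lessThan_iff)
    have "inj_on p {..<s}" using p by (metis inj_onI lessThan_iff)
    then have "card (p ` {..<s}) = s" by (simp add: card_image)
    moreover have "pairwise R (p ` {..<s})"
      unfolding pairwise_def R_def using p by (smt (verit, best) imageE lessThan_iff)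
    moreover have "p ` {..<s} \<subseteq> W" using p by auto
    ultimately show ?thesis by blast
  qed
  ultimately show ?thesis unfolding q_def w_def by blast
qed

subsection \<open>Cliques, independence numbers and degrees\<close>

lemma contains_complete_graph_iff:
  "contains_copy G (complete_graph s) \<longleftrightarrow>
    (\<exists>K. K \<subseteq> vertices G \<and> finite K \<and> card K = s \<and> [K]\<^bsup>2\<^esup> \<subseteq> edges G)"
proof
  assume "contains_copy G (complete_graph s)"
  then obtain \<phi> where \<phi>: "inj_on \<phi> {..<s}" "\<phi> ` {..<s} \<subseteq> vertices G" "\<forall>e\<in>[{..<s}]\<^bsup>2\<^esup>. \<phi> ` e \<in> edges G"
    by (auto simp: contains_copy_def complete_graph_def)
  have "[\<phi> ` {..<s}]\<^bsup>2\<^esup> \<subseteq> edges G"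
  proof
    fix e assume "e \<in> [\<phi> ` {..<s}]\<^bsup>2\<^esup>"
    then obtain i j where ij: "i < s" "j < s" "e = {\<phi> i, \<phi> j}" "\<phi> i \<noteq> \<phi> j"
      by (auto simp: nsets_2_eq)
    then have "{i, j} \<in> [{..<s}]\<^bsup>2\<^esup>" by (auto simp: nsets_2_eq)
    then show "e \<in> edges G" using \<phi>(3) ij by fastforce
  qed
  moreover have "card (\<phi> ` {..<s}) = s" using \<phi>(1) by (simp add: card_image)
  ultimately show "\<exists>K. K \<subseteq> vertices G \<and> finite K \<and> card K = s \<and> [K]\<^bsup>2\<^esup> \<subseteq> edges G"
    using \<phi>(2) by (intro exI[of _ "\<phi> ` {..<s}"]) auto
next
  assume "\<exists>K. K \<subseteq> vertices G \<and> finite K \<and> card K = s \<and> [K]\<^bsup>2\<^esup> \<subseteq> edges G"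
  then obtain K where K: "K \<subseteq> vertices G" "finite K" "card K = s" "[K]\<^bsup>2\<^esup> \<subseteq> edges G" by blast
  then obtain \<phi> where \<phi>: "bij_betw \<phi> {..<s} K"
    using ex_bij_betw_nat_finite[OF K(2)] by (auto simp: atLeast0LessThan)
  have "\<phi> ` e \<in> edges G" if "e \<in> [{..<s}]\<^bsup>2\<^esup>" for e
  proof -
    have "\<phi> ` e \<in> [K]\<^bsup>2\<^esup>"
      using that \<phi> by (auto simp: nsets_2_eq bij_betw_def inj_on_def)
    then show ?thesis using K(4) by blast
  qed
  then show "contains_copy G (complete_graph s)"
    using \<phi> K(1) by (auto simp: contains_copy_def complete_graph_def bij_betw_def)
qed

lemma card_le_independence_number:
  assumes "fin_simple_graph G" "s \<ge> 1" "S \<subseteq> vertices G"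
    and "\<not> contains_copy (induced_subgraph G S) (complete_graph s)"
  shows "card S \<le> independence_number s G"
  unfolding independence_number_def
  using independence_number_set(1)[OF assms(1,2)] assms(3,4) by (intro Max_ge) auto

lemma independence_number_less:
  assumes "fin_simple_graph G" "s \<ge> 1"
    and "\<And>S. S \<subseteq> vertices G \<Longrightarrow> \<not> contains_copy (induced_subgraph G S) (complete_graph s) \<Longrightarrow> card S < b"
  shows "independence_number s G < b"
  unfolding independence_number_def
  using independence_number_set[OF assms(1,2)] assms(3) by (subst Max_less_iff) auto

lemma card_neighbours_le:
  assumes G: "fin_simple_graph G" and s: "s \<ge> 1"
    and free: "\<not> contains_copy G (complete_graph (s + 1))" and v: "v \<in> vertices G"
  shows "card {u. {v, u} \<in> edges G} \<le> independence_number s G"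
proof (rule card_le_independence_number[OF G s])
  define N where "N = {u. {v, u} \<in> edges G}"
  have sub: "edges G \<subseteq> [vertices G]\<^bsup>2\<^esup>" using G by (simp add: fin_simple_graph_def)
  show "{u. {v, u} \<in> edges G} \<subseteq> vertices G"
    using sub by (auto simp: nsets_def)
  \<comment> \<open>Edges have two elements, so there are no loops; adding \<open>v\<close> to a
    clique among its neighbours really gives one more vertex.\<close>
  have vN: "v \<notin> N" using sub by (auto simp: N_def nsets_def)
  show "\<not> contains_copy (induced_subgraph G {u. {v, u} \<in> edges G}) (complete_graph s)"
    unfolding N_def[symmetric]
  proof
    assume "contains_copy (induced_subgraph G N) (complete_graph s)"
    then obtain K where K: "K \<subseteq> N" "finite K" "card K = s" "[K]\<^bsup>2\<^esup> \<subseteq> edges G"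
      unfolding contains_complete_graph_iff by (auto simp: induced_subgraph_def)
    have "[insert v K]\<^bsup>2\<^esup> \<subseteq> edges G"
    proof
      fix e assume "e \<in> [insert v K]\<^bsup>2\<^esup>"
      then obtain x y where xy: "x \<in> insert v K" "y \<in> insert v K" "x \<noteq> y" "e = {x, y}"
        by (auto simp: nsets_2_eq)
      consider "x = v" "y \<in> K" | "y = v" "x \<in> K" | "x \<in> K" "y \<in> K" using xy by blast
      then show "e \<in> edges G"
      proof cases
        case 1 then show ?thesis using K(1) xy(4) by (auto simp: N_def)
      next
        case 2 then show ?thesis using K(1) xy(4) by (auto simp: N_def insert_commute)
      next
        case 3 then show ?thesis using K(4) xy(3,4) by (auto simp: nsets_2_eq)
      qed
    qed
    moreover have "insert v K \<subseteq> vertices G"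
      using v K(1) sub by (auto simp: N_def nsets_def)
    moreover have "card (insert v K) = s + 1" using K vN by (subst card_insert_disjoint) auto
    ultimately show False using free K(2) unfolding contains_complete_graph_iff by blast
  qed
qed

text \<open>Summing the degree bound over all vertices covers each edge from both ends; the factor 2
  lost here does not affect the order of magnitude.\<close>

lemma card_edges_le:
  assumes "fin_simple_graph G" "s \<ge> 1" "\<not> contains_copy G (complete_graph (s + 1))"
  shows "card (edges G) \<le> card (vertices G) * independence_number s G"
proof -
  define N where "N v = {u. {v, u} \<in> edges G}" for v
  have fin: "finite (vertices G)" and sub: "edges G \<subseteq> [vertices G]\<^bsup>2\<^esup>"
    using assms(1) by (auto simp: fin_simple_graph_def)
  have N: "finite (N v)" for v
    using sub by (intro finite_subset[OF _ fin]) (auto simp: N_def nsets_def)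
  have "edges G \<subseteq> (\<Union>v\<in>vertices G. (\<lambda>u. {v, u}) ` N v)"
  proof
    fix e assume e: "e \<in> edges G"
    then have "e \<in> [vertices G]\<^bsup>2\<^esup>" using sub by blast
    then obtain v u where "v \<in> vertices G" "e = {v, u}" unfolding nsets_2_eq by blast
    then show "e \<in> (\<Union>v\<in>vertices G. (\<lambda>u. {v, u}) ` N v)" using e by (auto simp: N_def)
  qed
  then have "card (edges G) \<le> card (\<Union>v\<in>vertices G. (\<lambda>u. {v, u}) ` N v)"
    using fin N by (intro card_mono) auto
  also have "\<dots> \<le> (\<Sum>v\<in>vertices G. card ((\<lambda>u. {v, u}) ` N v))" by (rule card_UN_le[OF fin])
  also have "\<dots> \<le> (\<Sum>v\<in>vertices G. independence_number s G)"
    by (intro sum_mono order_trans[OF card_image_le[OF N]]) (unfold N_def, rule card_neighbours_le[OF assms])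
  finally show ?thesis by simp
qed

lemma RT_le:
  assumes "s \<ge> 1" "f n \<ge> 0"
  shows "real (RT s n (complete_graph (s + 1)) f) \<le> real n * f n"
proof (cases "RT_edge_counts s n (complete_graph (s + 1)) f = {}")
  \<comment> \<open>Here \<open>RT\<close> takes its default value 0, and the bound rests on
    \<open>f n \<ge> 0\<close>.\<close>
  case True
  then show ?thesis using assms by (simp add: RT_def)
next
  case False
  then have "RT s n (complete_graph (s + 1)) f \<in> RT_edge_counts s n (complete_graph (s + 1)) f"
    using Max_in[OF finite_RT_edge_counts] by (simp add: RT_def)
  then obtain G :: "nat graph" where G: "fin_simple_graph G" "card (vertices G) = n"
    "\<not> contains_copy G (complete_graph (s + 1))" "real (independence_number s G) < f n"
    "RT s n (complete_graph (s + 1)) f = card (edges G)"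
    unfolding RT_edge_counts_def by auto
  have "real (card (edges G)) \<le> real n * real (independence_number s G)"
    using card_edges_le[OF G(1) assms(1) G(3)] G(2) by (metis of_nat_le_iff of_nat_mult)
  also have "\<dots> \<le> real n * f n" using G(4) by (intro mult_left_mono) auto
  finally show ?thesis using G(5) by simp
qed

subsection \<open>A Turan bound, and blow-ups\<close>

text \<open>Ordered pairs make the induction below simple. For symmetric irreflexive
  \<open>R\<close> they count every edge twice, whence the factor 2 in
  \<open>card_edges_blow_up\<close>.\<close>

definition arcs :: "('a \<Rightarrow> 'a \<Rightarrow> bool) \<Rightarrow> 'a set \<Rightarrow> ('a \<times> 'a) set" where
  "arcs R A = {(x, y). x \<in> A \<and> y \<in> A \<and> R x y}"

text \<open>A largest independent set \<open>I\<close> has at most \<open>w\<close> points, and by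
  maximality the closed neighbourhoods of its points cover \<open>A\<close>. So one of them has at
  least \<open>card A / w\<close> elements.\<close>

lemma ex_many_neighbours:
  assumes A: "finite A" "A \<noteq> {}" and R: "symp R"
    and w: "\<And>I. I \<subseteq> A \<Longrightarrow> card I = w \<Longrightarrow> \<not> pairwise (\<lambda>x y. \<not> R x y) I"
  shows "\<exists>v\<in>A. card A \<le> w * Suc (card {u \<in> A. R v u})"
proof -
  define indep where "indep I \<longleftrightarrow> I \<subseteq> A \<and> pairwise (\<lambda>x y. \<not> R x y) I" for I
  have "\<exists>I. indep I \<and> (\<forall>J. indep J \<longrightarrow> card J \<le> card I)"
    using A(1) by (intro ex_has_greatest_nat[of _ "{}" _ "Suc (card A)"])
      (auto simp: indep_def less_Suc_eq_le intro: card_mono)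
  then obtain I where I: "indep I" and max: "\<And>J. indep J \<Longrightarrow> card J \<le> card I" by blast
  have fin: "finite I" and IA: "I \<subseteq> A" using I A(1) by (auto simp: indep_def intro: finite_subset)
  have "card I \<le> w"
  proof (rule ccontr)
    assume "\<not> card I \<le> w"
    then obtain J where "J \<subseteq> I" "card J = w" by (metis nat_le_linear obtain_subset_with_card_n)
    then show False using w[of J] I IA unfolding indep_def by (metis pairwise_mono order_trans order_refl)
  qed
  have "A \<subseteq> (\<Union>v\<in>I. insert v {u \<in> A. R v u})"
  proof
    fix x assume "x \<in> A"
    show "x \<in> (\<Union>v\<in>I. insert v {u \<in> A. R v u})"
    proof (rule ccontr)
      assume x: "x \<notin> (\<Union>v\<in>I. insert v {u \<in> A. R v u})"
      then have "x \<notin> I" "\<forall>v\<in>I. \<not> R v x" using \<open>x \<in> A\<close> by auto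
      moreover from this have "\<forall>v\<in>I. \<not> R x v" using R by (metis sympD)
      ultimately have "indep (insert x I)"
        using I \<open>x \<in> A\<close> by (auto simp: indep_def pairwise_insert)
      then show False using max[of "insert x I"] fin \<open>x \<notin> I\<close> by simp
    qed
  qed
  then have "card A \<le> card (\<Union>v\<in>I. insert v {u \<in> A. R v u})"
    using fin A(1) by (intro card_mono) auto
  also have "\<dots> \<le> (\<Sum>v\<in>I. card (insert v {u \<in> A. R v u}))" by (rule card_UN_le[OF fin])
  also have "\<dots> \<le> (\<Sum>v\<in>I. Suc (card {u \<in> A. R v u}))"
    by (intro sum_mono card_insert_le_m1) (auto simp: card_insert_if A(1))
  finally have le: "card A \<le> (\<Sum>v\<in>I. Suc (card {u \<in> A. R v u}))" .
  have "I \<noteq> {}" using le A by (auto simp: card_gt_0_iff)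
  define M where "M = Max ((\<lambda>v. Suc (card {u \<in> A. R v u})) ` I)"
  have "M \<in> (\<lambda>v. Suc (card {u \<in> A. R v u})) ` I"
    unfolding M_def using fin \<open>I \<noteq> {}\<close> by (intro Max_in) auto
  then obtain v where v: "v \<in> I" "M = Suc (card {u \<in> A. R v u})" by blast
  have "(\<Sum>v\<in>I. Suc (card {u \<in> A. R v u})) \<le> of_nat (card I) * M"
    using fin by (intro sum_bounded_above) (auto simp: M_def)
  also have "\<dots> \<le> w * M" using \<open>card I \<le> w\<close> by simp
  finally have "card A \<le> w * Suc (card {u \<in> A. R v u})" using le v(2) by simp
  then show ?thesis using v(1) IA by blast
qed

text \<open>Delete the vertex given by \<open>ex_many_neighbours\<close> repeatedly. Each deletion
  removes at least \<open>card A / w - 1\<close> arcs for the current \<open>A\<close>, and these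
  terms add up to the bound.\<close>

lemma card_arcs_ge:
  fixes w :: nat
  assumes "finite A" "symp R" "w > 0"
    and "\<And>I. I \<subseteq> A \<Longrightarrow> card I = w \<Longrightarrow> \<not> pairwise (\<lambda>x y. \<not> R x y) I"
  shows "(real (card A))^2 / (2 * w) - card A \<le> card (arcs R A)"
  using assms
proof (induction "card A" arbitrary: A)
  case 0
  then show ?case by simp
next
  case (Suc m)
  then have "A \<noteq> {}" by auto
  then obtain v where v: "v \<in> A" "card A \<le> w * Suc (card {u \<in> A. R v u})"
    using ex_many_neighbours[OF Suc.prems(1) _ Suc.prems(2,4)] by blast
  define B where "B = A - {v}"
  have B: "card B = m" "finite B" using Suc v by (auto simp: B_def)
  have IH: "(real m)^2 / (2 * w) - m \<le> card (arcs R B)"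
    using Suc.hyps(1)[of B] B Suc.prems unfolding B_def by (metis Diff_subset order_trans)
  have fin: "finite (arcs R X)" if "finite X" for X
    by (rule finite_subset[of _ "X \<times> X"]) (use that in \<open>auto simp: arcs_def\<close>)
  have "arcs R B \<union> Pair v ` {u \<in> A. R v u} \<subseteq> arcs R A"
    using v(1) by (auto simp: arcs_def B_def)
  then have "card (arcs R B \<union> Pair v ` {u \<in> A. R v u}) \<le> card (arcs R A)"
    by (intro card_mono fin Suc.prems(1))
  also have "card (arcs R B \<union> Pair v ` {u \<in> A. R v u}) = card (arcs R B) + card (Pair v ` {u \<in> A. R v u})"
    using Suc.prems(1) B(2) by (intro card_Un_disjoint fin) (auto simp: arcs_def B_def)
  also have "card (Pair v ` {u \<in> A. R v u}) = card {u \<in> A. R v u}"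
    by (intro card_image) (auto simp: inj_on_def)
  finally have arcs: "card (arcs R B) + card {u \<in> A. R v u} \<le> card (arcs R A)" .
  have "real (Suc m) \<le> real (w * Suc (card {u \<in> A. R v u}))"
    using v(2) Suc.hyps(2) by (simp only: of_nat_le_iff)
  then have "real (Suc m) / w \<le> 1 + card {u \<in> A. R v u}"
    using Suc.prems(3) by (simp add: field_simps)
  \<comment> \<open>The difference of the squares is \<open>2 * m + 1\<close>, which is at most
    \<open>2 * Suc m\<close>.\<close>
  moreover have "(real (Suc m))^2 / (2 * w) \<le> (real m)^2 / (2 * w) + real (Suc m) / w"
    using Suc.prems(3) by (simp add: field_simps power2_eq_square)
  ultimately show ?case using IH arcs Suc.hyps(2)[symmetric] by simp
qed

section \<open>Balanced blow-ups of a graph on \<open>{..<N}\<close>\<close>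

lemma card_mod_eq_le:
  assumes "N > 0"
  shows "card {i \<in> {..<n}. i mod N = r} \<le> n div N + 1"
proof -
  have "inj_on (\<lambda>i. i div N) {i \<in> {..<n}. i mod N = r}"
    by (rule inj_onI) (metis (mono_tags, lifting) div_mult_mod_eq mem_Collect_eq)
  moreover have "(\<lambda>i. i div N) ` {i \<in> {..<n}. i mod N = r} \<subseteq> {..n div N}"
    by (auto intro: div_le_mono)
  ultimately show ?thesis using card_inj_on_le[of _ _ "{..n div N}"] by fastforce
qed

text \<open>The parts are the residue classes modulo \<open>N\<close>, so their sizes differ by at
  most one. They are independent sets when \<open>R\<close> is irreflexive.\<close>

definition blow_up :: "nat \<Rightarrow> (nat \<Rightarrow> nat \<Rightarrow> bool) \<Rightarrow> nat \<Rightarrow> nat graph" where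
  "blow_up N R n = ({..<n}, {{i, j} |i j. i < n \<and> j < n \<and> R (i mod N) (j mod N)})"

context
  fixes N n :: nat and R :: "nat \<Rightarrow> nat \<Rightarrow> bool"
  assumes N: "N > 0" and R: "symp R" "irreflp R"
begin

lemma edge_blow_up_iff:
  "{i, j} \<in> edges (blow_up N R n) \<longleftrightarrow> i < n \<and> j < n \<and> R (i mod N) (j mod N)"
  using R(1) by (auto simp: blow_up_def doubleton_eq_iff dest: sympD)

lemma fin_simple_graph_blow_up: "fin_simple_graph (blow_up N R n)"
  using R(2) by (auto simp: blow_up_def fin_simple_graph_def nsets_def irreflp_def card_insert_if)

lemma blow_up_clique:
  assumes "K \<subseteq> {..<n}"
  shows "[K]\<^bsup>2\<^esup> \<subseteq> edges (blow_up N R n) \<longleftrightarrow> inj_on (\<lambda>i. i mod N) K \<and> pairwise R ((\<lambda>i. i mod N) ` K)"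
proof -
  have "[K]\<^bsup>2\<^esup> \<subseteq> edges (blow_up N R n) \<longleftrightarrow> (\<forall>i\<in>K. \<forall>j\<in>K. i \<noteq> j \<longrightarrow> {i, j} \<in> edges (blow_up N R n))"
    by (auto simp: nsets_2_eq)
  also have "\<dots> \<longleftrightarrow> (\<forall>i\<in>K. \<forall>j\<in>K. i \<noteq> j \<longrightarrow> R (i mod N) (j mod N))"
    unfolding edge_blow_up_iff using assms by blast
  also have "\<dots> \<longleftrightarrow> inj_on (\<lambda>i. i mod N) K \<and> pairwise R ((\<lambda>i. i mod N) ` K)"
    using R(2) unfolding inj_on_def pairwise_def irreflp_def by (auto; metis)
  finally show ?thesis .
qed

lemma blow_up_free:
  assumes "\<And>K. K \<subseteq> {..<N} \<Longrightarrow> card K = r \<Longrightarrow> \<not> pairwise R K"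
  shows "\<not> contains_copy (blow_up N R n) (complete_graph r)"
proof
  assume "contains_copy (blow_up N R n) (complete_graph r)"
  then obtain K where "K \<subseteq> {..<n}" "card K = r" "[K]\<^bsup>2\<^esup> \<subseteq> edges (blow_up N R n)"
    by (auto simp: contains_complete_graph_iff blow_up_def)
  moreover have "(\<lambda>i. i mod N) ` K \<subseteq> {..<N}" using N by auto
  ultimately show False
    using assms[of "(\<lambda>i. i mod N) ` K"] blow_up_clique[of K] by (simp add: card_image)
qed

text \<open>A set without \<open>K_s\<close> meets fewer than \<open>w\<close> parts, since among
  any \<open>w\<close> parts there is an \<open>R\<close>-clique of size \<open>s\<close> that lifts
  to the set. Every part has at most \<open>n div N + 1\<close> vertices.\<close>

lemma independence_number_blow_up:
  assumes "s \<ge> 1" "w > 0"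
    and W: "\<And>W. W \<subseteq> {..<N} \<Longrightarrow> card W = w \<Longrightarrow> \<exists>K\<subseteq>W. card K = s \<and> pairwise R K"
  shows "independence_number s (blow_up N R n) < w * (n div N + 1)"
proof (rule independence_number_less[OF fin_simple_graph_blow_up assms(1)])
  fix S assume "S \<subseteq> vertices (blow_up N R n)"
    and free: "\<not> contains_copy (induced_subgraph (blow_up N R n) S) (complete_graph s)"
  then have S: "S \<subseteq> {..<n}" by (simp add: blow_up_def)
  define T where "T = (\<lambda>i. i mod N) ` S"
  have T: "T \<subseteq> {..<N}" using N by (auto simp: T_def)
  have "card T < w"
  proof (rule ccontr)
    assume "\<not> card T < w"
    then obtain W where "W \<subseteq> T" "card W = w" by (meson not_less obtain_subset_with_card_n)
    then obtain L where L: "L \<subseteq> T" "card L = s" "pairwise R L" using W[of W] T by blast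
    \<comment> \<open>Lifting the clique means choosing one vertex of \<open>S\<close> in each part
      that belongs to \<open>L\<close>.\<close>
    then obtain K where K: "K \<subseteq> S" "inj_on (\<lambda>i. i mod N) K" "L = (\<lambda>i. i mod N) ` K"
      unfolding T_def by (meson subset_image_inj)
    then have "[K]\<^bsup>2\<^esup> \<subseteq> edges (blow_up N R n)" using blow_up_clique[of K] S L by blast
    moreover have "[K]\<^bsup>2\<^esup> \<subseteq> Pow S" using K(1) by (auto simp: nsets_def)
    ultimately have "[K]\<^bsup>2\<^esup> \<subseteq> edges (induced_subgraph (blow_up N R n) S)"
      by (auto simp: induced_subgraph_def)
    moreover have "K \<subseteq> vertices (induced_subgraph (blow_up N R n) S)"
      using K(1) by (simp add: induced_subgraph_def)
    moreover have "card K = s" using K L(2) by (simp add: card_image)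
    moreover have "finite K" using K(1) S by (meson finite_lessThan finite_subset)
    ultimately show False using free unfolding contains_complete_graph_iff by blast
  qed
  have "S \<subseteq> (\<Union>r\<in>T. {i \<in> {..<n}. i mod N = r})" using S by (auto simp: T_def)
  then have "card S \<le> card (\<Union>r\<in>T. {i \<in> {..<n}. i mod N = r})"
    using finite_subset[OF T] by (intro card_mono) auto
  also have "\<dots> \<le> (\<Sum>r\<in>T. card {i \<in> {..<n}. i mod N = r})"
    by (rule card_UN_le) (use T finite_subset in blast)
  also have "\<dots> \<le> card T * (n div N + 1)"
    using sum_bounded_above[of T "\<lambda>r. card {i \<in> {..<n}. i mod N = r}" "n div N + 1"] card_mod_eq_le[OF N]
    by simp
  also have "\<dots> < w * (n div N + 1)" using \<open>card T < w\<close> by (intro mult_strict_right_mono) auto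
  finally show "card S < w * (n div N + 1)" .
qed

text \<open>Every part contains \<open>n div N\<close> vertices \<open>x + N * i\<close> with
  \<open>i < n div N\<close>. So each arc of \<open>R\<close> yields \<open>(n div N)^2\<close>
  ordered pairs of adjacent vertices, and an edge comes from at most two ordered pairs.\<close>

lemma card_edges_blow_up:
  "(n div N)^2 * card (arcs R {..<N}) \<le> 2 * card (edges (blow_up N R n))"
proof -
  define t where "t = n div N"
  define G where "G = blow_up N R n"
  define h where "h = (\<lambda>((x, y), (i, j)). (x + N * i, y + N * j))"
  have fin: "finite (edges G)"
    using fin_simple_graph_blow_up by (auto simp: G_def fin_simple_graph_def intro: finite_imp_finite_nsets finite_subset)
  have e2: "finite {(i, j). {i, j} = e} \<and> card {(i, j). {i, j} = e} \<le> 2" if e: "e \<in> edges G" for e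
  proof -
    obtain a b where ab: "e = {a, b}" using e by (auto simp: G_def blow_up_def)
    have eq: "{(i, j). {i, j} = e} = {(a, b), (b, a)}" unfolding ab by (auto simp: doubleton_eq_iff)
    show ?thesis unfolding eq using card_insert_le_m1[of 2 "{(b, a)}" "(a, b)"] by simp
  qed
  have lt: "x + N * i < n" if "x < N" "i < t" for x i
  proof -
    have "x + N * i < N * Suc i" using that by simp
    also have "\<dots> \<le> N * t" using that by (intro mult_left_mono) auto
    also have "\<dots> \<le> n" by (simp add: t_def)
    finally show ?thesis .
  qed
  have "inj_on h (arcs R {..<N} \<times> ({..<t} \<times> {..<t}))"
  proof (rule inj_onI)
    fix p p' assume p: "p \<in> arcs R {..<N} \<times> ({..<t} \<times> {..<t})" "p' \<in> arcs R {..<N} \<times> ({..<t} \<times> {..<t})" "h p = h p'"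
    obtain x y i j where 1: "p = ((x, y), (i, j))" by (cases p, cases "fst p", cases "snd p") simp
    obtain x' y' i' j' where 2: "p' = ((x', y'), (i', j'))" by (cases p', cases "fst p'", cases "snd p'") simp
    have *: "a = a' \<and> b = b'" if "a + N * b = a' + N * b'" "a < N" "a' < N" for a a' b b'
    proof -
      have "(a + N * b) mod N = a" "(a' + N * b') mod N = a'" "(a + N * b) div N = b" "(a' + N * b') div N = b'"
        using that(2,3) by auto
      then show ?thesis using that(1) by metis
    qed
    show "p = p'" using p *[of x i x' i'] *[of y j y' j'] unfolding 1 2 by (auto simp: h_def arcs_def)
  qed
  then have "card (arcs R {..<N} \<times> ({..<t} \<times> {..<t})) = card (h ` (arcs R {..<N} \<times> ({..<t} \<times> {..<t})))"
    by (simp add: card_image)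
  also have "h ` (arcs R {..<N} \<times> ({..<t} \<times> {..<t})) \<subseteq> (\<Union>e\<in>edges G. {(i, j). {i, j} = e})"
  proof
    fix z assume "z \<in> h ` (arcs R {..<N} \<times> ({..<t} \<times> {..<t}))"
    then obtain x y i j where "x < N" "y < N" "R x y" "i < t" "j < t" "z = (x + N * i, y + N * j)"
      by (auto simp: h_def arcs_def)
    then show "z \<in> (\<Union>e\<in>edges G. {(i, j). {i, j} = e})"
      using lt by (auto simp: G_def edge_blow_up_iff)
  qed
  then have "card (h ` (arcs R {..<N} \<times> ({..<t} \<times> {..<t}))) \<le> card (\<Union>e\<in>edges G. {(i, j). {i, j} = e})"
    using fin e2 by (intro card_mono finite_UN_I) auto
  also have "\<dots> \<le> (\<Sum>e\<in>edges G. card {(i, j). {i, j} = e})" by (rule card_UN_le[OF fin])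
  also have "\<dots> \<le> 2 * card (edges G)"
    using sum_bounded_above[of "edges G" "\<lambda>e. card {(i, j). {i, j} = e}" 2] e2 by (simp add: mult.commute)
  finally show ?thesis by (simp add: t_def G_def card_cartesian_product power2_eq_square mult.commute)
qed

end

text \<open>Renames the grid points by natural numbers, as the blow-up along residues
  requires.\<close>

lemma ex_nat_graph:
  fixes m s D :: nat
  assumes "s \<ge> 6 * m" "s \<ge> 2" "D \<ge> 2" "s^2 * D ^ (2 * m) * (s - 1) ^ D < s ^ D"
  shows "\<exists>R. symp R \<and> irreflp R \<and>
    (\<forall>K\<subseteq>{..<D ^ (2 * m)}. card K = Suc s \<longrightarrow> \<not> pairwise R K) \<and>
    (\<forall>W\<subseteq>{..<D ^ (2 * m)}. card W = D ^ (m + 6) \<longrightarrow> (\<exists>K\<subseteq>W. card K = s \<and> pairwise R K))"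
proof -
  obtain R where R: "symp R" "irreflp R"
    and free: "\<forall>K\<subseteq>grid (D ^ m). card K = Suc s \<longrightarrow> \<not> pairwise R K"
    and full: "\<forall>W\<subseteq>grid (D ^ m). card W = D ^ (m + 6) \<longrightarrow> (\<exists>K\<subseteq>W. card K = s \<and> pairwise R K)"
    using ex_grid_graph[OF assms] by (elim exE conjE) (rule that)
  have "card (grid (D ^ m)) = D ^ (2 * m)" by (simp add: card_grid mult.commute flip: power_mult)
  then obtain g where g: "bij_betw g {..<D ^ (2 * m)} (grid (D ^ m))"
    using ex_bij_betw_nat_finite[OF finite_grid[of "D ^ m"]] by (auto simp: atLeast0LessThan)
  define R' where "R' i j = R (g i) (g j)" for i j
  have inj: "inj_on g X" if "X \<subseteq> {..<D ^ (2 * m)}" for X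
    using g that by (auto simp: bij_betw_def intro: inj_on_subset)
  have pw: "pairwise R (g ` X) \<longleftrightarrow> pairwise R' X" if "X \<subseteq> {..<D ^ (2 * m)}" for X
    using inj[OF that] unfolding pairwise_def R'_def by (auto dest: inj_onD)
  have sub: "g ` X \<subseteq> grid (D ^ m)" if "X \<subseteq> {..<D ^ (2 * m)}" for X
    using g that by (auto simp: bij_betw_def)
  have "symp R'" unfolding R'_def by (intro sympI) (rule sympD[OF R(1)])
  moreover have "irreflp R'" unfolding R'_def by (intro irreflpI) (rule irreflpD[OF R(2)])
  moreover have "\<not> pairwise R' K" if "K \<subseteq> {..<D ^ (2 * m)}" "card K = Suc s" for K
    using free sub[OF that(1)] pw[OF that(1)] inj[OF that(1)] that(2) by (metis card_image)
  moreover have "\<exists>K\<subseteq>W. card K = s \<and> pairwise R' K" if W: "W \<subseteq> {..<D ^ (2 * m)}" "card W = D ^ (m + 6)" for W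
  proof -
    have "card (g ` W) = D ^ (m + 6)" using inj[OF W(1)] W(2) by (simp add: card_image)
    then obtain L where "L \<subseteq> g ` W" "card L = s" "pairwise R L" using full sub[OF W(1)] by blast
    then obtain K where "K \<subseteq> W" "inj_on g K" "L = g ` K" by (meson subset_image_inj)
    then show ?thesis using pw[of K] W(1) \<open>card L = s\<close> \<open>pairwise R L\<close> by (metis card_image order_trans)
  qed
  ultimately show ?thesis by blast
qed

subsection \<open>Bounds for Ramsey--Turan numbers\<close>

lemma card_edges_le_RT:
  fixes G :: "nat graph"
  assumes "fin_simple_graph G" "\<not> contains_copy G H" "real (independence_number s G) < f (card (vertices G))"
  shows "card (edges G) \<le> RT s (card (vertices G)) H f"
proof -
  have "card (edges G) \<in> RT_edge_counts s (card (vertices G)) H f"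
    using assms unfolding RT_edge_counts_def by blast
  then show ?thesis unfolding RT_def using Max_ge[OF finite_RT_edge_counts] by (metis empty_iff)
qed

text \<open>Blow up the grid graph for \<open>m = M + 6\<close>, where \<open>N = w * D ^ M\<close>.
  Its independence number is below \<open>2 * w * t\<close>, at most \<open>2 * n / D ^ M\<close>
  and so at most \<open>f n\<close>. The Turan bound gives at least \<open>N * D ^ M / 4\<close>
  arcs, hence at least \<open>t^2 * N * D ^ M / 8\<close> edges; with
  \<open>n \<le> 2 * t * N\<close> this is at least \<open>n^2 / (32 * w)\<close>.\<close>

lemma RT_ge:
  fixes M s D n :: nat
  assumes s: "s \<ge> 6 * (M + 6)" and D: "D \<ge> 2" "D ^ M \<ge> 4"
    and small: "s^2 * D ^ (2 * (M + 6)) * (s - 1) ^ D < s ^ D"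
    and n: "D ^ (2 * (M + 6)) \<le> n" and f: "2 * real n \<le> real D ^ M * f n"
  shows "(real n)^2 / (32 * real D ^ (M + 12)) \<le> real (RT s n (complete_graph (s + 1)) f)"
proof -
  define N where "N = D ^ (2 * (M + 6))"
  define w where "w = D ^ (M + 12)"
  define t where "t = n div N"
  have pos: "N > 0" "w > 0" using D by (auto simp: N_def w_def)
  have N: "N = w * D ^ M" by (simp add: N_def w_def mult_2 algebra_simps flip: power_add)
  obtain R where R: "symp R" "irreflp R"
    and free: "\<forall>K\<subseteq>{..<N}. card K = Suc s \<longrightarrow> \<not> pairwise R K"
    and full: "\<forall>W\<subseteq>{..<N}. card W = w \<longrightarrow> (\<exists>K\<subseteq>W. card K = s \<and> pairwise R K)"
  proof -
    have w: "w = D ^ (M + 6 + 6)" unfolding w_def by (rule arg_cong[where f = "\<lambda>k. D ^ k"]) simp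
    have "s \<ge> 2" using s by simp
    show ?thesis
      using ex_nat_graph[OF s \<open>s \<ge> 2\<close> D(1) small] unfolding N_def[symmetric] w[symmetric]
      by (elim exE conjE) (rule that)
  qed
  define G where "G = blow_up N R n"
  have vG: "card (vertices G) = n" by (simp add: G_def blow_up_def)
  have t1: "t \<ge> 1" using n pos unfolding t_def N_def[symmetric] by (simp add: Suc_leI div_greater_zero_iff)
  have tn: "real t * real N \<le> real n"
    unfolding t_def by (metis of_nat_le_iff of_nat_mult div_times_less_eq_dividend)
  have "n < (t + 1) * N" unfolding t_def by (metis Suc_eq_plus1 dividend_less_div_times mult_Suc pos(1))
  then have "real n < (real t + 1) * real N" by (metis of_nat_less_iff of_nat_mult of_nat_Suc Suc_eq_plus1 add.commute)
  also have "\<dots> \<le> 2 * real t * real N" using t1 by (intro mult_right_mono) auto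
  finally have nt: "real n \<le> 2 * real t * real N" by simp
  have "independence_number s G < w * (t + 1)"
    unfolding G_def t_def using full s
    by (intro independence_number_blow_up[OF pos(1) R _ pos(2)]) auto
  then have "real (independence_number s G) < real w * (real t + 1)"
    by (metis of_nat_less_iff of_nat_mult of_nat_Suc Suc_eq_plus1 add.commute)
  also have "\<dots> \<le> real w * (2 * real t)" using t1 by (intro mult_left_mono) auto
  also have "\<dots> \<le> f n"
  proof -
    have "real D ^ M * (real w * (2 * real t)) = 2 * (real t * real N)" by (simp add: N)
    also have "\<dots> \<le> real D ^ M * f n" using tn f by linarith
    finally show ?thesis using D(1) by simp
  qed
  finally have "real (independence_number s G) < f n" .
  then have RT: "card (edges G) \<le> RT s n (complete_graph (s + 1)) f"
    using card_edges_le_RT[of G "complete_graph (s + 1)" s f] vG blow_up_free[OF pos(1) R, of "s + 1" n] free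
      fin_simple_graph_blow_up[OF pos(1) R, of n] by (simp add: G_def)
  \<comment> \<open>Any \<open>w\<close> vertices contain a clique of size \<open>s \<ge> 2\<close>,
    hence an adjacent pair, so the Turan bound applies.\<close>
  have "\<not> pairwise (\<lambda>x y. \<not> R x y) I" if IN: "I \<subseteq> {..<N}" "card I = w" for I
  proof
    assume I: "pairwise (\<lambda>x y. \<not> R x y) I"
    obtain K where K: "K \<subseteq> I" "card K = s" "pairwise R K" using full[rule_format, OF IN] by (elim exE conjE) (rule that)
    have "finite K" "\<not> card K \<le> Suc 0" using K(2) s by (auto intro: card_ge_0_finite)
    then obtain x y where "x \<in> K" "y \<in> K" "x \<noteq> y" using card_le_Suc0_iff_eq by blast
    then show False using I K unfolding pairwise_def by blast
  qed
  then have "(real N)^2 / (2 * w) - N \<le> card (arcs R {..<N})"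
    using card_arcs_ge[of "{..<N}" R w] R(1) pos by simp
  moreover have "(real N)^2 / (2 * w) - N = N * (real D ^ M / 2 - 1)"
    using pos by (simp add: N power2_eq_square field_simps)
  moreover have "N * (real D ^ M / 4) \<le> N * (real D ^ M / 2 - 1)"
  proof (intro mult_left_mono)
    have "real 4 \<le> real (D ^ M)" using D(2) by (simp only: of_nat_le_iff)
    then show "real D ^ M / 4 \<le> real D ^ M / 2 - 1" by simp
  qed auto
  ultimately have arcs: "N * (real D ^ M / 4) \<le> card (arcs R {..<N})" by linarith
  have "(real n)^2 / (32 * real D ^ (M + 12)) = (real n)^2 / (32 * real w)" by (simp add: w_def)
  also have "\<dots> \<le> (2 * real t * real N)^2 / (32 * real w)"
    using nt by (intro divide_right_mono power_mono) auto
  also have "\<dots> = (real t)^2 * (N * (real D ^ M / 4)) / 2"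
    using pos by (simp add: N power2_eq_square field_simps)
  also have "\<dots> \<le> (real t)^2 * card (arcs R {..<N}) / 2"
    using arcs by (intro divide_right_mono mult_left_mono) auto
  also have "\<dots> \<le> card (edges G)"
  proof -
    have "real (t^2 * card (arcs R {..<N})) \<le> real (2 * card (edges G))"
      using card_edges_blow_up[OF pos(1) R, of n] unfolding G_def t_def by (simp only: of_nat_le_iff)
    then show ?thesis by simp
  qed
  also have "\<dots> \<le> RT s n (complete_graph (s + 1)) f" using RT by simp
  finally show ?thesis .
qed

text \<open>Choose \<open>D\<close> of order \<open>n powr \<gamma>\<close>, so that
  \<open>D ^ M\<close> has order \<open>n powr (1 - \<delta>)\<close>. The surplus 12 in the
  exponents of \<open>N\<close> and \<open>w\<close> costs a factor of order
  \<open>n powr (12 * \<gamma>)\<close>, where \<open>12 * \<gamma> \<le> 12 / M\<close>. This is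
  below \<open>2 * \<delta> - 1\<close>, which makes \<open>N \<le> n\<close> for large
  \<open>n\<close>, and at most \<open>\<epsilon>\<close>, which controls the loss in
  \<open>n^2 / w\<close>.\<close>

lemma RT_lower_asymp:
  fixes \<epsilon> \<delta> :: real and M s :: nat
  assumes \<delta>: "1/2 < \<delta>" "\<delta> < 1" and M: "M > 0" "12 / M \<le> \<epsilon>" "12 / M < 2 * \<delta> - 1"
    and s: "s \<ge> 6 * (M + 6)"
  shows "(\<lambda>n. real (RT s n (complete_graph (s + 1)) (\<lambda>n. real n powr \<delta>)))
    \<in> \<Omega>(\<lambda>n. real n powr (1 + \<delta> - \<epsilon>))"
proof -
  define \<gamma> where "\<gamma> = (1 - \<delta>) / M"
  \<comment> \<open>The factor 2 yields \<open>2 * n powr (1 - \<delta>) \<le> D n ^ M\<close>,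
    which is what the threshold condition of \<open>RT_ge\<close> asks for.\<close>
  define D where "D n = nat \<lceil>2 * real n powr \<gamma>\<rceil>" for n :: nat
  have \<gamma>: "\<gamma> > 0" using \<delta> M by (simp add: \<gamma>_def)
  have lim: "filterlim D at_top at_top"
    unfolding D_def using \<gamma> by real_asymp
  have \<gamma>M: "\<gamma> * M = 1 - \<delta>" using M by (simp add: \<gamma>_def)
  have \<gamma>12: "\<gamma> * 12 \<le> 12 / M" using \<delta> M(1) by (simp add: \<gamma>_def field_simps)
  have "\<gamma> * real (2 * (M + 6)) = 2 * (1 - \<delta>) + \<gamma> * 12" using \<gamma>M by (simp add: algebra_simps)
  also have "\<dots> < 1" using \<gamma>12 M(3) by simp
  finally have exp1: "\<gamma> * real (2 * (M + 6)) < 1" .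
  have "\<gamma> * real (M + 12) = 1 - \<delta> + \<gamma> * 12" using \<gamma>M by (simp add: algebra_simps)
  then have exp2: "\<gamma> * real (M + 12) \<le> 1 - \<delta> + \<epsilon>" using \<gamma>12 M(2) by simp
  have "eventually (\<lambda>n. s^2 * D n ^ (2 * (M + 6)) * (s - 1) ^ D n < s ^ D n) at_top"
    using eventually_compose_filterlim[OF eventually_power_mult_less[of s "2 * (M + 6)"] lim] s by simp
  moreover have "eventually (\<lambda>n. D n \<ge> 4) at_top"
    using lim by (simp add: filterlim_at_top)
  moreover have "eventually (\<lambda>n. 3 ^ (2 * (M + 6)) * real n powr (\<gamma> * real (2 * (M + 6))) \<le> real n) at_top"
    using exp1 by real_asymp
  moreover have "eventually (\<lambda>n::nat. n \<ge> 1) at_top" by (rule eventually_ge_at_top)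
  ultimately have "eventually (\<lambda>n. norm (real (RT s n (complete_graph (s + 1)) (\<lambda>n. real n powr \<delta>)))
      \<ge> 1 / (32 * 3 ^ (M + 12)) * norm (real n powr (1 + \<delta> - \<epsilon>))) at_top"
  proof eventually_elim
    case (elim n)
    define x where "x = real n powr \<gamma>"
    have x: "x \<ge> 1" using elim(4) \<gamma> by (simp add: x_def ge_one_powr_ge_zero)
    have xpow: "x ^ k = real n powr (\<gamma> * real k)" for k
      using elim(4) by (simp add: x_def powr_powr flip: powr_realpow)
    have Dge: "2 * x \<le> real (D n)" unfolding D_def x_def by linarith
    \<comment> \<open>Rounding up adds at most 1, and \<open>1 \<le> x\<close>; hence the powers of
      3 in the constants.\<close>
    have Dle: "real (D n) \<le> 3 * x" using x unfolding D_def x_def by linarith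
    have "real (D n ^ (2 * (M + 6))) \<le> (3 * x) ^ (2 * (M + 6))"
      unfolding of_nat_power using Dle by (intro power_mono) auto
    also have "\<dots> \<le> real n" using elim(3) by (simp add: power_mult_distrib xpow del: power_add_numeral mult_Suc)
    finally have n: "D n ^ (2 * (M + 6)) \<le> n" by (simp only: of_nat_le_iff)
    have "D n ^ 1 \<le> D n ^ M" using M(1) elim(2) by (intro power_increasing) auto
    then have D4: "D n ^ M \<ge> 4" using elim(2) by simp
    have "2 * real n powr (1 - \<delta>) = 2 * x ^ M" using \<gamma>M by (simp add: xpow)
    also have "2 * x ^ M \<le> 2 ^ M * x ^ M"
      using M(1) x self_le_power[of "2::real" M] by (intro mult_right_mono) auto
    also have "\<dots> = (2 * x) ^ M" by (rule power_mult_distrib[symmetric])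
    also have "\<dots> \<le> real (D n) ^ M" using Dge x by (intro power_mono) auto
    finally have DM: "2 * real n powr (1 - \<delta>) \<le> real (D n) ^ M" .
    have "2 * real n = (2 * real n powr (1 - \<delta>)) * real n powr \<delta>"
      using elim(4) by (simp flip: powr_add)
    also have "\<dots> \<le> real (D n) ^ M * real n powr \<delta>" using DM by (intro mult_right_mono) auto
    finally have f: "2 * real n \<le> real (D n) ^ M * real n powr \<delta>" .
    have "real n powr (1 + \<delta> - \<epsilon>) * real (D n) ^ (M + 12) \<le> real n powr (1 + \<delta> - \<epsilon>) * (3 * x) ^ (M + 12)"
      using Dle by (intro mult_left_mono power_mono) auto
    also have "\<dots> = 3 ^ (M + 12) * real n powr (1 + \<delta> - \<epsilon> + \<gamma> * real (M + 12))"
      by (simp add: power_mult_distrib xpow powr_add del: power_add_numeral of_nat_add)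
    also have "\<dots> \<le> 3 ^ (M + 12) * real n powr 2"
      using exp2 elim(4) by (intro mult_left_mono powr_mono) auto
    also have "real n powr 2 = (real n)^2" using elim(4) by simp
    finally have "1 / (32 * 3 ^ (M + 12)) * real n powr (1 + \<delta> - \<epsilon>) \<le> (real n)^2 / (32 * real (D n) ^ (M + 12))"
      using elim(2) by (simp add: field_simps)
    also have "\<dots> \<le> real (RT s n (complete_graph (s + 1)) (\<lambda>n. real n powr \<delta>))"
      using elim(2) by (intro RT_ge[where f = "\<lambda>n. real n powr \<delta>", OF s _ D4 elim(1) n f]) auto
    finally show ?case by simp
  qed
  then show ?thesis by (intro landau_omega.bigI[of "1 / (32 * 3 ^ (M + 12))"]) auto
qed

theorem theorem6p1:
  fixes \<epsilon> \<delta> :: real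
  assumes "\<epsilon> > 0" and "1/2 < \<delta>" and "\<delta> < 1"
  shows "\<exists>s\<^sub>0\<ge>2. \<forall>s\<ge>s\<^sub>0.
    (\<lambda>n. real (RT s n (complete_graph (s + 1)) (\<lambda>n. real n powr \<delta>)))
        \<in> \<Omega>(\<lambda>n. real n powr (1 + \<delta> - \<epsilon>)) \<and>
    (\<lambda>n. real (RT s n (complete_graph (s + 1)) (\<lambda>n. real n powr \<delta>)))
        \<in> O(\<lambda>n. real n powr (1 + \<delta>))"
proof -
  \<comment> \<open>An \<open>M\<close> above \<open>12 / c\<close> meets both conditions on
    \<open>12 / M\<close> in \<open>RT_lower_asymp\<close>, and it depends on
    \<open>\<epsilon>\<close> and \<open>\<delta>\<close> only. Thus \<open>6 * (M + 6)\<close> can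
    serve as \<open>s\<^sub>0\<close>.\<close>
  define c where "c = min \<epsilon> (2 * \<delta> - 1)"
  have c: "c > 0" using assms by (simp add: c_def)
  obtain M :: nat where M': "12 / c < real M" using reals_Archimedean2 by blast
  moreover have "12 / c > 0" using c by simp
  ultimately have "0 < real M" by linarith
  then have M: "M > 0" "12 / M < c" using M' c by (simp_all add: field_simps)
  have "(\<lambda>n. real (RT s n (complete_graph (s + 1)) (\<lambda>n. real n powr \<delta>))) \<in> O(\<lambda>n. real n powr (1 + \<delta>))"
    if "s \<ge> 1" for s
  proof (rule landau_o.bigI[of 1])
    show "eventually (\<lambda>n. norm (real (RT s n (complete_graph (s + 1)) (\<lambda>n. real n powr \<delta>)))
        \<le> 1 * norm (real n powr (1 + \<delta>))) at_top"
      using eventually_ge_at_top[of 1]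
    proof eventually_elim
      case (elim n)
      then show ?case
        using RT_le[OF that, of "\<lambda>n. real n powr \<delta>" n] by (simp add: powr_add)
    qed
  qed simp
  moreover have "(\<lambda>n. real (RT s n (complete_graph (s + 1)) (\<lambda>n. real n powr \<delta>)))
      \<in> \<Omega>(\<lambda>n. real n powr (1 + \<delta> - \<epsilon>))" if "s \<ge> 6 * (M + 6)" for s
    using RT_lower_asymp[OF assms(2,3) M(1) _ _ that] M(2) by (simp add: c_def)
  ultimately show ?thesis by (intro exI[of _ "6 * (M + 6)"]) auto
qed

end
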